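(* Let $\mathbb{A}$ be a double category with companions. A cell $\alpha$ of $\mathbb{A}$ with top $f\colon A\to B$, left $v\colon A\nrightarrow C$, right $w\colon B\nrightarrow D$, bottom $g\colon C\to D$ is a commuter cell if and only if $\alpha\colon v\to w$, regarded as a horizontal arrow of the double category $\mathbb{V}\mathrm{ar}(\mathbb{A})$, has a companion in $\mathbb{V}\mathrm{ar}(\mathbb{A})$.
   Context: Double categories. A double category $\mathbb{A}$ has objects, horizontal arrows (composed strictly: composite $gf$, identity $1_A$), vertical arrows $v\colon A\nrightarrow C$ (composite $w\bullet v$ meaning $v$ first, identity $\mathrm{id}_A$; vertical composition is associative up to coherent isomorphism, vertical identities are taken strict) and cells. A cell has a top $f\colon A\to B$, a bottom $g\colon C\to D$ (horizontal arrows), a left side $v\colon A\nrightarrow C$ and a right side $w\colon B\nrightarrow D$ (vertical arrows). $\alpha\mid\beta$ denotes horizontal pasting ($\alpha$ left of $\beta$) and $\frac{\alpha}{\beta}$ vertical pasting ($\alpha$ above $\beta$); $1_v$ is the horizontal identity cell on $v$ and $\mathrm{id}_f$ the vertical identity cell on $f$. A globular cell $v\Rightarrow w$ has left $v$, right $w$ and identity top and bottom. Associativity isomorphisms are suppressed. Companions. A companion of $f\colon A\to B$ is a vertical arrow $f_*\colon A\nrightarrow B$ with binding cells $\psi_f$ (top $1_A$, left $\mathrm{id}_A$, right $f_*$, bottom $f$) and $\chi_f$ (top $f$, left $f_*$, right $\mathrm{id}_B$, bottom $1_B$) with $\psi_f\mid\chi_f=\mathrm{id}_f$ and $\frac{\psi_f}{\chi_f}=1_{f_*}$.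 Companions in $\mathbb{A}$ are chosen, with $(1_A)_*=\mathrm{id}_A$; there are canonical isomorphisms $(hf)_*\cong h_*\bullet f_*$. Retrocells. A retrocell with top $f$, left $v$, right $w$, bottom $g$ is a globular cell $w\bullet f_*\Rightarrow g_*\bullet v$. The horizontal composite of $\alpha\colon w\bullet f_*\Rightarrow g_*\bullet v$ and $\beta\colon x\bullet h_*\Rightarrow k_*\bullet w$ is $x\bullet(hf)_*\cong x\bullet h_*\bullet f_*\Rightarrow k_*\bullet w\bullet f_*\Rightarrow k_*\bullet g_*\bullet v\cong(kg)_*\bullet v$. Commuter cells. A cell $\alpha$ as in the claim is a commuter cell if the globular cell $\widehat{\alpha}\colon g_*\bullet v\Rightarrow w\bullet f_*$, the vertical pasting of $\psi_f$, $\alpha$, $\chi_g$ (top to bottom), is a horizontal isomorphism (invertible under horizontal composition). The double category $\mathbb{V}\mathrm{ar}(\mathbb{A})$. Objects: vertical arrows of $\mathbb{A}$. Horizontal arrows $v\to w$: cells of $\mathbb{A}$ with left $v$ and right $w$, composed horizontally. Vertical arrows $v\nrightarrow v'$: retrocells with left $v$ and right $v'$, composed by horizontal composition of retrocells. It is thin: given a horizontal arrow $\alpha\colon v\to w$ (cell with top $f\colon A\to B$, bottom $g\colon C\to D$), a horizontal arrow $\alpha'\colon v'\to w'$ (cell with top $f'\colon A'\to B'$, bottom $g'\colon C'\to D'$), a vertical arrow $\beta\colon v\nrightarrow v'$ (retrocell with top $a\colon A\to A'$, bottom $c\colon C\to C'$, i.e. $\beta\colon v'\bullet a_*\Rightarrow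 c_*\bullet v$) and a vertical arrow $\gamma\colon w\nrightarrow w'$ (retrocell with top $b\colon B\to B'$, bottom $d\colon D\to D'$, i.e. $\gamma\colon w'\bullet b_*\Rightarrow d_*\bullet w$), there is a unique cell with top $\alpha$, left $\beta$, right $\gamma$, bottom $\alpha'$ if $f'a=bf$, $g'c=dg$ and $\beta\,\big|\,\frac{\alpha}{\ast_1}=\frac{\ast_2}{\alpha'}\,\big|\,\gamma$, and none otherwise. Here $\ast_1$ is the canonical cell with top $g$, left $c_*$, right $d_*$, bottom $g'$, namely $(\mathrm{id}_g\mid\psi_d)$ pasted above $(\chi_c\mid\mathrm{id}_{g'})$, and $\ast_2$ is the canonical cell with top $f$, left $a_*$, right $b_*$, bottom $f'$, namely $(\mathrm{id}_f\mid\psi_b)$ pasted above $(\chi_a\mid\mathrm{id}_{f'})$. *)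

theory Defs
  imports Main
begin

text \<open>Horizontal arrows compose strictly, and \<open>g \<cdot> f\<close> means \<open>f\<close> first;
  vertical arrows compose weakly, and \<open>w \<bullet> v\<close> means \<open>v\<close> first.
  \<open>\<alpha> \<parallel> \<beta>\<close> is horizontal pasting (\<open>\<alpha>\<close> left of \<open>\<beta>\<close>) and
  \<open>\<alpha> \<div> \<beta>\<close> is vertical pasting (\<open>\<alpha>\<close> above \<open>\<beta>\<close>).
  \<open>hunit v\<close> is the horizontal identity cell \<open>1\<^sub>v\<close> and \<open>vunit f\<close> the vertical identity
  cell \<open>id\<^sub>f\<close>. \<open>vassoc v w x\<close> is the associativity cell
  \<open>(x \<bullet> w) \<bullet> v \<Rightarrow> x \<bullet> (w \<bullet> v)\<close>.\<close>

record ('o, 'h, 'v, 'c) double_cat =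
  Obj :: "'o set"
  Hor :: "'h set"
  Ver :: "'v set"
  Sq :: "'c set"
  hsrc :: "'h \<Rightarrow> 'o"
  htgt :: "'h \<Rightarrow> 'o"
  vsrc :: "'v \<Rightarrow> 'o"
  vtgt :: "'v \<Rightarrow> 'o"
  hid :: "'o \<Rightarrow> 'h"
  vid :: "'o \<Rightarrow> 'v"
  hcomp :: "'h \<Rightarrow> 'h \<Rightarrow> 'h" (infixr \<open>\<cdot>\<index>\<close> 75)
  vcomp :: "'v \<Rightarrow> 'v \<Rightarrow> 'v" (infixr \<open>\<bullet>\<index>\<close> 75)
  ctop :: "'c \<Rightarrow> 'h"
  cleft :: "'c \<Rightarrow> 'v"
  cright :: "'c \<Rightarrow> 'v"
  cbot :: "'c \<Rightarrow> 'h"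
  hunit :: "'v \<Rightarrow> 'c"
  vunit :: "'h \<Rightarrow> 'c"
  hpaste :: "'c \<Rightarrow> 'c \<Rightarrow> 'c" (infixl \<open>\<parallel>\<index>\<close> 65)
  vpaste :: "'c \<Rightarrow> 'c \<Rightarrow> 'c" (infixl \<open>\<div>\<index>\<close> 70)
  vassoc :: "'v \<Rightarrow> 'v \<Rightarrow> 'v \<Rightarrow> 'c"

definition is_cell ::
    "('o, 'h, 'v, 'c, 'z) double_cat_scheme \<Rightarrow> 'h \<Rightarrow> 'v \<Rightarrow> 'v \<Rightarrow> 'h \<Rightarrow> 'c \<Rightarrow> bool" where
  "is_cell A f v w g \<alpha> \<longleftrightarrow>
     \<alpha> \<in> Sq A \<and> ctop A \<alpha> = f \<and> cleft A \<alpha> = v \<and> cright A \<alpha> = w \<and> cbot A \<alpha> = g"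

definition is_globular ::
    "('o, 'h, 'v, 'c, 'z) double_cat_scheme \<Rightarrow> 'v \<Rightarrow> 'v \<Rightarrow> 'c \<Rightarrow> bool" where
  "is_globular A v w \<alpha> \<longleftrightarrow> is_cell A (hid A (vsrc A v)) v w (hid A (vtgt A v)) \<alpha>"

definition is_hinverse :: "('o, 'h, 'v, 'c, 'z) double_cat_scheme \<Rightarrow> 'c \<Rightarrow> 'c \<Rightarrow> bool" where
  "is_hinverse A \<alpha> \<beta> \<longleftrightarrow>
     \<beta> \<in> Sq A \<and> cleft A \<beta> = cright A \<alpha> \<and> cright A \<beta> = cleft A \<alpha> \<and>
     \<alpha> \<parallel>\<^bsub>A\<^esub> \<beta> = hunit A (cleft A \<alpha>) \<and> \<beta> \<parallel>\<^bsub>A\<^esub> \<alpha> = hunit A (cright A \<alpha>)"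

definition is_hiso :: "('o, 'h, 'v, 'c, 'z) double_cat_scheme \<Rightarrow> 'c \<Rightarrow> bool" where
  "is_hiso A \<alpha> \<longleftrightarrow> (\<exists>\<beta>. is_hinverse A \<alpha> \<beta>)"

definition hinv :: "('o, 'h, 'v, 'c, 'z) double_cat_scheme \<Rightarrow> 'c \<Rightarrow> 'c" where
  "hinv A \<alpha> = (THE \<beta>. is_hinverse A \<alpha> \<beta>)"

text \<open>Since vertical identities are strict, the unit coherence (triangle) law says that
  associativity cells with middle argument an identity are identities; by the pentagon, so
  are those with first or last argument an identity.\<close>

locale double_category =
  fixes A :: "('o, 'h, 'v, 'c, 'z) double_cat_scheme" (structure)
  assumes hsrc_in: "f \<in> Hor A \<Longrightarrow> hsrc A f \<in> Obj A"
    and htgt_in: "f \<in> Hor A \<Longrightarrow> htgt A f \<in> Obj A"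
    and hid_in: "a \<in> Obj A \<Longrightarrow> hid A a \<in> Hor A"
    and hsrc_hid: "a \<in> Obj A \<Longrightarrow> hsrc A (hid A a) = a"
    and htgt_hid: "a \<in> Obj A \<Longrightarrow> htgt A (hid A a) = a"
    and hcomp_in: "\<lbrakk>f \<in> Hor A; g \<in> Hor A; htgt A f = hsrc A g\<rbrakk> \<Longrightarrow> g \<cdot> f \<in> Hor A"
    and hsrc_hcomp: "\<lbrakk>f \<in> Hor A; g \<in> Hor A; htgt A f = hsrc A g\<rbrakk>
      \<Longrightarrow> hsrc A (g \<cdot> f) = hsrc A f"
    and htgt_hcomp: "\<lbrakk>f \<in> Hor A; g \<in> Hor A; htgt A f = hsrc A g\<rbrakk>
      \<Longrightarrow> htgt A (g \<cdot> f) = htgt A g"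
    and hcomp_assoc: "\<lbrakk>f \<in> Hor A; g \<in> Hor A; h \<in> Hor A; htgt A f = hsrc A g; htgt A g = hsrc A h\<rbrakk>
      \<Longrightarrow> (h \<cdot> g) \<cdot> f = h \<cdot> (g \<cdot> f)"
    and hcomp_hid_left: "f \<in> Hor A \<Longrightarrow> hid A (htgt A f) \<cdot> f = f"
    and hcomp_hid_right: "f \<in> Hor A \<Longrightarrow> f \<cdot> hid A (hsrc A f) = f"
    and vsrc_in: "v \<in> Ver A \<Longrightarrow> vsrc A v \<in> Obj A"
    and vtgt_in: "v \<in> Ver A \<Longrightarrow> vtgt A v \<in> Obj A"
    and vid_in: "a \<in> Obj A \<Longrightarrow> vid A a \<in> Ver A"
    and vsrc_vid: "a \<in> Obj A \<Longrightarrow> vsrc A (vid A a) = a"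
    and vtgt_vid: "a \<in> Obj A \<Longrightarrow> vtgt A (vid A a) = a"
    and vcomp_in: "\<lbrakk>v \<in> Ver A; w \<in> Ver A; vtgt A v = vsrc A w\<rbrakk> \<Longrightarrow> w \<bullet> v \<in> Ver A"
    and vsrc_vcomp: "\<lbrakk>v \<in> Ver A; w \<in> Ver A; vtgt A v = vsrc A w\<rbrakk>
      \<Longrightarrow> vsrc A (w \<bullet> v) = vsrc A v"
    and vtgt_vcomp: "\<lbrakk>v \<in> Ver A; w \<in> Ver A; vtgt A v = vsrc A w\<rbrakk>
      \<Longrightarrow> vtgt A (w \<bullet> v) = vtgt A w"
    and vcomp_vid_left: "v \<in> Ver A \<Longrightarrow> vid A (vtgt A v) \<bullet> v = v"
    and vcomp_vid_right: "v \<in> Ver A \<Longrightarrow> v \<bullet> vid A (vsrc A v) = v"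
    and ctop_in: "\<alpha> \<in> Sq A \<Longrightarrow> ctop A \<alpha> \<in> Hor A"
    and cleft_in: "\<alpha> \<in> Sq A \<Longrightarrow> cleft A \<alpha> \<in> Ver A"
    and cright_in: "\<alpha> \<in> Sq A \<Longrightarrow> cright A \<alpha> \<in> Ver A"
    and cbot_in: "\<alpha> \<in> Sq A \<Longrightarrow> cbot A \<alpha> \<in> Hor A"
    and corner_tl: "\<alpha> \<in> Sq A \<Longrightarrow> vsrc A (cleft A \<alpha>) = hsrc A (ctop A \<alpha>)"
    and corner_tr: "\<alpha> \<in> Sq A \<Longrightarrow> vsrc A (cright A \<alpha>) = htgt A (ctop A \<alpha>)"
    and corner_bl: "\<alpha> \<in> Sq A \<Longrightarrow> vtgt A (cleft A \<alpha>) = hsrc A (cbot A \<alpha>)"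
    and corner_br: "\<alpha> \<in> Sq A \<Longrightarrow> vtgt A (cright A \<alpha>) = htgt A (cbot A \<alpha>)"
    and hunit_cell: "v \<in> Ver A \<Longrightarrow> is_globular A v v (hunit A v)"
    and vunit_cell: "f \<in> Hor A
      \<Longrightarrow> is_cell A f (vid A (hsrc A f)) (vid A (htgt A f)) f (vunit A f)"
    and hpaste_cell: "\<lbrakk>\<alpha> \<in> Sq A; \<beta> \<in> Sq A; cright A \<alpha> = cleft A \<beta>\<rbrakk>
      \<Longrightarrow> is_cell A (ctop A \<beta> \<cdot> ctop A \<alpha>) (cleft A \<alpha>) (cright A \<beta>) (cbot A \<beta> \<cdot> cbot A \<alpha>) (\<alpha> \<parallel> \<beta>)"
    and vpaste_cell: "\<lbrakk>\<alpha> \<in> Sq A; \<beta> \<in> Sq A; cbot A \<alpha> = ctop A \<beta>\<rbrakk>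
      \<Longrightarrow> is_cell A (ctop A \<alpha>) (cleft A \<beta> \<bullet> cleft A \<alpha>) (cright A \<beta> \<bullet> cright A \<alpha>) (cbot A \<beta>) (\<alpha> \<div> \<beta>)"
    and hpaste_assoc: "\<lbrakk>\<alpha> \<in> Sq A; \<beta> \<in> Sq A; \<gamma> \<in> Sq A; cright A \<alpha> = cleft A \<beta>; cright A \<beta> = cleft A \<gamma>\<rbrakk>
      \<Longrightarrow> (\<alpha> \<parallel> \<beta>) \<parallel> \<gamma> = \<alpha> \<parallel> (\<beta> \<parallel> \<gamma>)"
    and hpaste_hunit_left: "\<alpha> \<in> Sq A \<Longrightarrow> hunit A (cleft A \<alpha>) \<parallel> \<alpha> = \<alpha>"
    and hpaste_hunit_right: "\<alpha> \<in> Sq A \<Longrightarrow> \<alpha> \<parallel> hunit A (cright A \<alpha>) = \<alpha>"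
    and vpaste_vunit_top: "\<alpha> \<in> Sq A \<Longrightarrow> vunit A (ctop A \<alpha>) \<div> \<alpha> = \<alpha>"
    and vpaste_vunit_bot: "\<alpha> \<in> Sq A \<Longrightarrow> \<alpha> \<div> vunit A (cbot A \<alpha>) = \<alpha>"
    and interchange: "\<lbrakk>\<alpha> \<in> Sq A; \<beta> \<in> Sq A; \<gamma> \<in> Sq A; \<delta> \<in> Sq A;
        cright A \<alpha> = cleft A \<beta>; cright A \<gamma> = cleft A \<delta>; cbot A \<alpha> = ctop A \<gamma>; cbot A \<beta> = ctop A \<delta>\<rbrakk>
      \<Longrightarrow> (\<alpha> \<parallel> \<beta>) \<div> (\<gamma> \<parallel> \<delta>) = (\<alpha> \<div> \<gamma>) \<parallel> (\<beta> \<div> \<delta>)"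
    and hunit_vcomp: "\<lbrakk>v \<in> Ver A; w \<in> Ver A; vtgt A v = vsrc A w\<rbrakk>
      \<Longrightarrow> hunit A v \<div> hunit A w = hunit A (w \<bullet> v)"
    and vunit_hcomp: "\<lbrakk>f \<in> Hor A; g \<in> Hor A; htgt A f = hsrc A g\<rbrakk>
      \<Longrightarrow> vunit A f \<parallel> vunit A g = vunit A (g \<cdot> f)"
    and hunit_vid: "a \<in> Obj A \<Longrightarrow> hunit A (vid A a) = vunit A (hid A a)"
    and vassoc_cell: "\<lbrakk>v \<in> Ver A; w \<in> Ver A; x \<in> Ver A; vtgt A v = vsrc A w; vtgt A w = vsrc A x\<rbrakk>
      \<Longrightarrow> is_globular A ((x \<bullet> w) \<bullet> v) (x \<bullet> (w \<bullet> v)) (vassoc A v w x)"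
    and vassoc_iso: "\<lbrakk>v \<in> Ver A; w \<in> Ver A; x \<in> Ver A; vtgt A v = vsrc A w; vtgt A w = vsrc A x\<rbrakk>
      \<Longrightarrow> is_hiso A (vassoc A v w x)"
    and vassoc_natural: "\<lbrakk>\<alpha> \<in> Sq A; \<beta> \<in> Sq A; \<gamma> \<in> Sq A; cbot A \<alpha> = ctop A \<beta>; cbot A \<beta> = ctop A \<gamma>\<rbrakk>
      \<Longrightarrow> (\<alpha> \<div> (\<beta> \<div> \<gamma>)) \<parallel> vassoc A (cright A \<alpha>) (cright A \<beta>) (cright A \<gamma>)
        = vassoc A (cleft A \<alpha>) (cleft A \<beta>) (cleft A \<gamma>) \<parallel> ((\<alpha> \<div> \<beta>) \<div> \<gamma>)"
    and pentagon: "\<lbrakk>u \<in> Ver A; v \<in> Ver A; w \<in> Ver A; x \<in> Ver A;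
        vtgt A u = vsrc A v; vtgt A v = vsrc A w; vtgt A w = vsrc A x\<rbrakk>
      \<Longrightarrow> vassoc A u v (x \<bullet> w) \<parallel> vassoc A (v \<bullet> u) w x
        = (hunit A u \<div> vassoc A v w x) \<parallel> vassoc A u (w \<bullet> v) x \<parallel> (vassoc A u v w \<div> hunit A x)"
    and triangle: "\<lbrakk>v \<in> Ver A; x \<in> Ver A; vtgt A v = vsrc A x\<rbrakk>
      \<Longrightarrow> vassoc A v (vid A (vtgt A v)) x = hunit A (x \<bullet> v)"

definition is_companion ::
    "('o, 'h, 'v, 'c, 'z) double_cat_scheme \<Rightarrow> 'h \<Rightarrow> 'v \<Rightarrow> 'c \<Rightarrow> 'c \<Rightarrow> bool" where
  "is_companion A f p \<psi> \<chi> \<longleftrightarrow>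
     p \<in> Ver A \<and> vsrc A p = hsrc A f \<and> vtgt A p = htgt A f \<and>
     is_cell A (hid A (hsrc A f)) (vid A (hsrc A f)) p f \<psi> \<and>
     is_cell A f p (vid A (htgt A f)) (hid A (htgt A f)) \<chi> \<and>
     \<psi> \<parallel>\<^bsub>A\<^esub> \<chi> = vunit A f \<and>
     \<psi> \<div>\<^bsub>A\<^esub> \<chi> = hunit A p"

definition has_companion :: "('o, 'h, 'v, 'c, 'z) double_cat_scheme \<Rightarrow> 'h \<Rightarrow> bool" where
  "has_companion A f \<longleftrightarrow> (\<exists>p \<psi> \<chi>. is_companion A f p \<psi> \<chi>)"

record ('o, 'h, 'v, 'c) double_cat_comp = "('o, 'h, 'v, 'c) double_cat" +
  star :: "'h \<Rightarrow> 'v"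
  psi :: "'h \<Rightarrow> 'c"
  chi :: "'h \<Rightarrow> 'c"

locale double_category_with_companions =
  double_category A for A :: "('o, 'h, 'v, 'c, 'z) double_cat_comp_scheme" (structure) +
  assumes companion: "f \<in> Hor A \<Longrightarrow> is_companion A f (star A f) (psi A f) (chi A f)"
    and star_hid: "a \<in> Obj A \<Longrightarrow> star A (hid A a) = vid A a"

text \<open>The canonical isomorphism \<open>(h \<cdot> f)\<^sub>* \<Rightarrow> h\<^sub>* \<bullet> f\<^sub>*\<close> and its inverse: binding cells
  exhibiting \<open>h\<^sub>* \<bullet> f\<^sub>*\<close> as a companion of \<open>h \<cdot> f\<close> are pasted with those of \<open>(h \<cdot> f)\<^sub>*\<close>.\<close>

definition star_split :: "('o, 'h, 'v, 'c, 'z) double_cat_comp_scheme \<Rightarrow> 'h \<Rightarrow> 'h \<Rightarrow> 'c" where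
  "star_split A h f =
     (psi A f \<div>\<^bsub>A\<^esub> (vunit A f \<parallel>\<^bsub>A\<^esub> psi A h)) \<div>\<^bsub>A\<^esub> chi A (h \<cdot>\<^bsub>A\<^esub> f)"

definition star_merge :: "('o, 'h, 'v, 'c, 'z) double_cat_comp_scheme \<Rightarrow> 'h \<Rightarrow> 'h \<Rightarrow> 'c" where
  "star_merge A h f =
     psi A (h \<cdot>\<^bsub>A\<^esub> f) \<div>\<^bsub>A\<^esub> ((chi A f \<parallel>\<^bsub>A\<^esub> vunit A h) \<div>\<^bsub>A\<^esub> chi A h)"

record ('h, 'v, 'c) retrocell =
  rtop :: "'h"
  rleft :: "'v"
  rright :: "'v"
  rbot :: "'h"
  rcell :: "'c"

definition is_retrocell ::
    "('o, 'h, 'v, 'c, 'z) double_cat_comp_scheme \<Rightarrow> ('h, 'v, 'c) retrocell \<Rightarrow> bool" where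
  "is_retrocell A \<rho> \<longleftrightarrow>
     rtop \<rho> \<in> Hor A \<and> rbot \<rho> \<in> Hor A \<and> rleft \<rho> \<in> Ver A \<and> rright \<rho> \<in> Ver A \<and>
     hsrc A (rtop \<rho>) = vsrc A (rleft \<rho>) \<and> htgt A (rtop \<rho>) = vsrc A (rright \<rho>) \<and>
     hsrc A (rbot \<rho>) = vtgt A (rleft \<rho>) \<and> htgt A (rbot \<rho>) = vtgt A (rright \<rho>) \<and>
     is_globular A (rright \<rho> \<bullet>\<^bsub>A\<^esub> star A (rtop \<rho>)) (star A (rbot \<rho>) \<bullet>\<^bsub>A\<^esub> rleft \<rho>) (rcell \<rho>)"

text \<open>With \<open>\<rho> : w \<bullet> f\<^sub>* \<Rightarrow> g\<^sub>* \<bullet> v\<close> and \<open>\<sigma> : x \<bullet> h\<^sub>* \<Rightarrow> k\<^sub>* \<bullet> w\<close>, the cell below is the composite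
  \<open>x \<bullet> (h \<cdot> f)\<^sub>* \<cong> x \<bullet> (h\<^sub>* \<bullet> f\<^sub>*) \<cong> (x \<bullet> h\<^sub>*) \<bullet> f\<^sub>* \<Rightarrow> (k\<^sub>* \<bullet> w) \<bullet> f\<^sub>* \<cong> k\<^sub>* \<bullet> (w \<bullet> f\<^sub>*)
  \<Rightarrow> k\<^sub>* \<bullet> (g\<^sub>* \<bullet> v) \<cong> (k\<^sub>* \<bullet> g\<^sub>*) \<bullet> v \<cong> (k \<cdot> g)\<^sub>* \<bullet> v\<close>.\<close>

definition retro_comp ::
    "('o, 'h, 'v, 'c, 'z) double_cat_comp_scheme \<Rightarrow> ('h, 'v, 'c) retrocell \<Rightarrow> ('h, 'v, 'c) retrocell
     \<Rightarrow> ('h, 'v, 'c) retrocell" where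
  "retro_comp A \<rho> \<sigma> =
     (let f = rtop \<rho>; g = rbot \<rho>; v = rleft \<rho>; w = rright \<rho>;
          h = rtop \<sigma>; k = rbot \<sigma>; x = rright \<sigma>
      in \<lparr>rtop = h \<cdot>\<^bsub>A\<^esub> f, rleft = v, rright = x, rbot = k \<cdot>\<^bsub>A\<^esub> g,
          rcell =
            (star_split A h f \<div>\<^bsub>A\<^esub> hunit A x)
            \<parallel>\<^bsub>A\<^esub> hinv A (vassoc A (star A f) (star A h) x)
            \<parallel>\<^bsub>A\<^esub> (hunit A (star A f) \<div>\<^bsub>A\<^esub> rcell \<sigma>)
            \<parallel>\<^bsub>A\<^esub> vassoc A (star A f) w (star A k)
            \<parallel>\<^bsub>A\<^esub> (rcell \<rho> \<div>\<^bsub>A\<^esub> hunit A (star A k))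
            \<parallel>\<^bsub>A\<^esub> hinv A (vassoc A v (star A g) (star A k))
            \<parallel>\<^bsub>A\<^esub> (hunit A v \<div>\<^bsub>A\<^esub> star_merge A k g)\<rparr>)"

text \<open>The unit for \<open>retro_comp\<close>. Although \<open>(1\<^sub>A)\<^sub>* = id\<^sub>A\<close>, the binding cells of \<open>1\<^sub>A\<close> need not be
  identities, so the unit is the canonical cell \<open>v \<bullet> (1\<^sub>A)\<^sub>* \<Rightarrow> (1\<^sub>C)\<^sub>* \<bullet> v\<close>; it is \<open>1\<^sub>v\<close> when they
  are.\<close>

definition retro_id :: "('o, 'h, 'v, 'c, 'z) double_cat_comp_scheme \<Rightarrow> 'v \<Rightarrow> ('h, 'v, 'c) retrocell" where
  "retro_id A v =
     \<lparr>rtop = hid A (vsrc A v), rleft = v, rright = v, rbot = hid A (vtgt A v),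
      rcell = (chi A (hid A (vsrc A v)) \<div>\<^bsub>A\<^esub> hunit A v) \<div>\<^bsub>A\<^esub> psi A (hid A (vtgt A v))\<rparr>"

text \<open>The cell with top \<open>g\<close>, left \<open>c\<^sub>*\<close>, right \<open>d\<^sub>*\<close>, bottom \<open>g'\<close> arising from
  \<open>g' \<cdot> c = d \<cdot> g\<close>.\<close>

definition star_square ::
    "('o, 'h, 'v, 'c, 'z) double_cat_comp_scheme \<Rightarrow> 'h \<Rightarrow> 'h \<Rightarrow> 'h \<Rightarrow> 'h \<Rightarrow> 'c" where
  "star_square A g c d g' =
     (vunit A g \<parallel>\<^bsub>A\<^esub> psi A d) \<div>\<^bsub>A\<^esub> (chi A c \<parallel>\<^bsub>A\<^esub> vunit A g')"

text \<open>A cell of \<open>Var A\<close> is determined by its boundary.\<close>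

record ('h, 'v, 'c) var_cell =
  vc_top :: "'c"
  vc_left :: "('h, 'v, 'c) retrocell"
  vc_right :: "('h, 'v, 'c) retrocell"
  vc_bot :: "'c"

definition is_var_cell ::
    "('o, 'h, 'v, 'c, 'z) double_cat_comp_scheme \<Rightarrow> ('h, 'v, 'c) var_cell \<Rightarrow> bool" where
  "is_var_cell A s \<longleftrightarrow>
     (let \<alpha> = vc_top s; \<beta> = vc_left s; \<gamma> = vc_right s; \<alpha>' = vc_bot s;
          f = ctop A \<alpha>; g = cbot A \<alpha>; f' = ctop A \<alpha>'; g' = cbot A \<alpha>';
          a = rtop \<beta>; c = rbot \<beta>; b = rtop \<gamma>; d = rbot \<gamma>
      in \<alpha> \<in> Sq A \<and> \<alpha>' \<in> Sq A \<and> is_retrocell A \<beta> \<and> is_retrocell A \<gamma> \<and>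
         rleft \<beta> = cleft A \<alpha> \<and> rleft \<gamma> = cright A \<alpha> \<and>
         rright \<beta> = cleft A \<alpha>' \<and> rright \<gamma> = cright A \<alpha>' \<and>
         f' \<cdot>\<^bsub>A\<^esub> a = b \<cdot>\<^bsub>A\<^esub> f \<and> g' \<cdot>\<^bsub>A\<^esub> c = d \<cdot>\<^bsub>A\<^esub> g \<and>
         rcell \<beta> \<parallel>\<^bsub>A\<^esub> (\<alpha> \<div>\<^bsub>A\<^esub> star_square A g c d g')
           = (star_square A f a b f' \<div>\<^bsub>A\<^esub> \<alpha>') \<parallel>\<^bsub>A\<^esub> rcell \<gamma>)"

definition Var ::
    "('o, 'h, 'v, 'c, 'z) double_cat_comp_scheme
     \<Rightarrow> ('v, 'c, ('h, 'v, 'c) retrocell, ('h, 'v, 'c) var_cell) double_cat" where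
  "Var A =
     \<lparr>Obj = Ver A, Hor = Sq A, Ver = {\<rho>. is_retrocell A \<rho>}, Sq = {s. is_var_cell A s},
      hsrc = cleft A, htgt = cright A, vsrc = rleft, vtgt = rright,
      hid = hunit A, vid = retro_id A,
      hcomp = (\<lambda>\<beta> \<alpha>. \<alpha> \<parallel>\<^bsub>A\<^esub> \<beta>),
      vcomp = (\<lambda>\<sigma> \<rho>. retro_comp A \<rho> \<sigma>),
      ctop = vc_top, cleft = vc_left, cright = vc_right, cbot = vc_bot,
      hunit = (\<lambda>\<rho>. \<lparr>vc_top = hunit A (rleft \<rho>), vc_left = \<rho>, vc_right = \<rho>,
                    vc_bot = hunit A (rright \<rho>)\<rparr>),
      vunit = (\<lambda>\<alpha>. \<lparr>vc_top = \<alpha>, vc_left = retro_id A (cleft A \<alpha>),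
                    vc_right = retro_id A (cright A \<alpha>), vc_bot = \<alpha>\<rparr>),
      hpaste = (\<lambda>s t. \<lparr>vc_top = vc_top s \<parallel>\<^bsub>A\<^esub> vc_top t, vc_left = vc_left s,
                       vc_right = vc_right t, vc_bot = vc_bot s \<parallel>\<^bsub>A\<^esub> vc_bot t\<rparr>),
      vpaste = (\<lambda>s t. \<lparr>vc_top = vc_top s, vc_left = retro_comp A (vc_left s) (vc_left t),
                       vc_right = retro_comp A (vc_right s) (vc_right t), vc_bot = vc_bot t\<rparr>),
      vassoc = (\<lambda>\<rho> \<sigma> \<tau>. let \<kappa> = retro_comp A \<rho> (retro_comp A \<sigma> \<tau>)
                  in \<lparr>vc_top = hunit A (rleft \<rho>), vc_left = \<kappa>, vc_right = \<kappa>,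
                      vc_bot = hunit A (rright \<tau>)\<rparr>)\<rparr>"

definition commuter_hat :: "('o, 'h, 'v, 'c, 'z) double_cat_comp_scheme \<Rightarrow> 'c \<Rightarrow> 'c" where
  "commuter_hat A \<alpha> = (psi A (ctop A \<alpha>) \<div>\<^bsub>A\<^esub> \<alpha>) \<div>\<^bsub>A\<^esub> chi A (cbot A \<alpha>)"

definition commuter_cell :: "('o, 'h, 'v, 'c, 'z) double_cat_comp_scheme \<Rightarrow> 'c \<Rightarrow> bool" where
  "commuter_cell A \<alpha> \<longleftrightarrow> is_hiso A (commuter_hat A \<alpha>)"

end

theory Submission
  imports Defs
begin

text \<open>Let \<open>\<eta>\<close> be the globular cell \<open>\<psi>\<^sub>f \<div> \<alpha> \<div> \<chi>\<^sub>g : g\<^sub>* \<bullet> v \<Rightarrow> w \<bullet> f\<^sub>*\<close>. A companion of \<open>\<alpha>\<close> in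
  \<open>Var A\<close> is a retrocell \<open>\<beta>\<close> from \<open>v\<close> to \<open>w\<close> with two binding cells. The boundaries force the top
  and bottom of \<open>\<beta>\<close> to be \<open>f\<close> and \<open>g\<close>, so \<open>\<beta> : w \<bullet> f\<^sub>* \<Rightarrow> g\<^sub>* \<bullet> v\<close> has the type of an inverse of
  \<open>\<eta>\<close>, and thinness turns the existence of the binding cells into two equations. If the
  binding cells of identity arrows are identities, these equations read
  \<open>(\<psi>\<^sub>f \<div> \<alpha>) \<parallel> \<beta> = 1\<^sub>v \<div> \<psi>\<^sub>g\<close> and \<open>\<beta> \<parallel> (\<alpha> \<div> \<chi>\<^sub>g) = \<chi>\<^sub>f \<div> 1\<^sub>w\<close>; in general both sides carry an
  extra factor \<open>\<chi>\<close> or \<open>\<psi>\<close> of an identity arrow, which is invertible and cancels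
  (\<open>var_psi_iff\<close>, \<open>var_chi_iff\<close>).

  Pasting \<open>\<chi>\<^sub>g\<close> below the first equation gives \<open>\<eta> \<parallel> \<beta> = 1\<close>, and pasting \<open>\<psi>\<^sub>f\<close> above the second
  gives \<open>\<beta> \<parallel> \<eta> = 1\<close>. Conversely \<open>(1\<^sub>v \<div> \<psi>\<^sub>g) \<parallel> \<eta> = \<psi>\<^sub>f \<div> \<alpha>\<close> and
  \<open>\<eta> \<parallel> (\<chi>\<^sub>f \<div> 1\<^sub>w) = \<alpha> \<div> \<chi>\<^sub>g\<close>, so the equations follow when \<open>\<beta>\<close> is an inverse
  (\<open>is_hinverse_commuter_hat_iff\<close>).

  It remains to see that such binding cells satisfy the companion equations. The equation for
  \<open>\<psi> \<parallel> \<chi>\<close> holds by comparing boundaries, and the one for \<open>\<psi> \<div> \<chi>\<close> amounts to the unit laws for the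
  composition of retrocells (\<open>retro_comp_retro_id_left\<close>, \<open>retro_comp_retro_id_right\<close>). The only
  coherence involved is that associativity cells with an identity among their arguments are
  trivial: each triple pasting that is reassociated contains, on either side, an identity.\<close>

text \<open>The binding cells of identity arrows are of this kind. Such cells form a commutative monoid
  by the Eckmann--Hilton argument, hence the name.\<close>

definition is_scalar :: "('o, 'h, 'v, 'c, 'z) double_cat_scheme \<Rightarrow> 'o \<Rightarrow> 'c \<Rightarrow> bool" where
  "is_scalar A a x \<longleftrightarrow> a \<in> Obj A \<and> is_cell A (hid A a) (vid A a) (vid A a) (hid A a) x"

context double_category
begin

section \<open>Boundaries and units\<close>

lemmas arrow_boundaries [simp] =
  hsrc_in htgt_in hid_in hsrc_hid htgt_hid hcomp_in hsrc_hcomp htgt_hcomp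
  vsrc_in vtgt_in vid_in vsrc_vid vtgt_vid vcomp_in vsrc_vcomp vtgt_vcomp
  ctop_in cleft_in cright_in cbot_in hunit_vid

lemma hunit_boundary [simp]:
  assumes "v \<in> Ver A"
  shows "hunit A v \<in> Sq A" "ctop A (hunit A v) = hid A (vsrc A v)" "cleft A (hunit A v) = v"
    "cright A (hunit A v) = v" "cbot A (hunit A v) = hid A (vtgt A v)"
  using hunit_cell[OF assms] by (auto simp: is_globular_def is_cell_def)

lemma vunit_boundary [simp]:
  assumes "f \<in> Hor A"
  shows "vunit A f \<in> Sq A" "ctop A (vunit A f) = f" "cleft A (vunit A f) = vid A (hsrc A f)"
    "cright A (vunit A f) = vid A (htgt A f)" "cbot A (vunit A f) = f"
  using vunit_cell[OF assms] by (auto simp: is_cell_def)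

lemma hpaste_boundary [simp]:
  assumes "\<alpha> \<in> Sq A" "\<beta> \<in> Sq A" "cright A \<alpha> = cleft A \<beta>"
  shows "\<alpha> \<parallel> \<beta> \<in> Sq A" "ctop A (\<alpha> \<parallel> \<beta>) = ctop A \<beta> \<cdot> ctop A \<alpha>" "cleft A (\<alpha> \<parallel> \<beta>) = cleft A \<alpha>"
    "cright A (\<alpha> \<parallel> \<beta>) = cright A \<beta>" "cbot A (\<alpha> \<parallel> \<beta>) = cbot A \<beta> \<cdot> cbot A \<alpha>"
  using hpaste_cell[OF assms] by (auto simp: is_cell_def)

lemma vpaste_boundary [simp]:
  assumes "\<alpha> \<in> Sq A" "\<beta> \<in> Sq A" "cbot A \<alpha> = ctop A \<beta>"
  shows "\<alpha> \<div> \<beta> \<in> Sq A" "ctop A (\<alpha> \<div> \<beta>) = ctop A \<alpha>" "cleft A (\<alpha> \<div> \<beta>) = cleft A \<beta> \<bullet> cleft A \<alpha>"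
    "cright A (\<alpha> \<div> \<beta>) = cright A \<beta> \<bullet> cright A \<alpha>" "cbot A (\<alpha> \<div> \<beta>) = cbot A \<beta>"
  using vpaste_cell[OF assms] by (auto simp: is_cell_def)

lemma arrow_units [simp]:
  "\<lbrakk>f \<in> Hor A; htgt A f = a\<rbrakk> \<Longrightarrow> hid A a \<cdot> f = f"
  "\<lbrakk>f \<in> Hor A; hsrc A f = a\<rbrakk> \<Longrightarrow> f \<cdot> hid A a = f"
  "\<lbrakk>v \<in> Ver A; vtgt A v = a\<rbrakk> \<Longrightarrow> vid A a \<bullet> v = v"
  "\<lbrakk>v \<in> Ver A; vsrc A v = a\<rbrakk> \<Longrightarrow> v \<bullet> vid A a = v"
  using hcomp_hid_left hcomp_hid_right vcomp_vid_left vcomp_vid_right by auto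

lemma cell_units [simp]:
  "\<lbrakk>\<alpha> \<in> Sq A; cleft A \<alpha> = v\<rbrakk> \<Longrightarrow> hunit A v \<parallel> \<alpha> = \<alpha>"
  "\<lbrakk>\<alpha> \<in> Sq A; cright A \<alpha> = v\<rbrakk> \<Longrightarrow> \<alpha> \<parallel> hunit A v = \<alpha>"
  "\<lbrakk>\<alpha> \<in> Sq A; ctop A \<alpha> = f\<rbrakk> \<Longrightarrow> vunit A f \<div> \<alpha> = \<alpha>"
  "\<lbrakk>\<alpha> \<in> Sq A; cbot A \<alpha> = f\<rbrakk> \<Longrightarrow> \<alpha> \<div> vunit A f = \<alpha>"
  using hpaste_hunit_left hpaste_hunit_right vpaste_vunit_top vpaste_vunit_bot by auto

text \<open>The identity cell on an identity arrow is a unit for both pastings, by \<open>hunit_vid\<close>.\<close>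

lemma double_identity_units [simp]:
  "\<lbrakk>a \<in> Obj A; \<alpha> \<in> Sq A; cleft A \<alpha> = vid A a\<rbrakk> \<Longrightarrow> vunit A (hid A a) \<parallel> \<alpha> = \<alpha>"
  "\<lbrakk>a \<in> Obj A; \<alpha> \<in> Sq A; cright A \<alpha> = vid A a\<rbrakk> \<Longrightarrow> \<alpha> \<parallel> vunit A (hid A a) = \<alpha>"
  by (simp_all flip: hunit_vid)

section \<open>Associativity in the presence of identities\<close>

lemma hinv_hunit: "v \<in> Ver A \<Longrightarrow> hinv A (hunit A v) = hunit A v"
  unfolding hinv_def by (rule the_equality) (auto simp: is_hinverse_def)

lemma hiso_idempotent:
  assumes "\<alpha> \<in> Sq A" "is_hiso A \<alpha>" "cleft A \<alpha> = v" "cright A \<alpha> = v" "\<alpha> \<parallel> \<alpha> = \<alpha>"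
  shows "\<alpha> = hunit A v"
proof -
  obtain \<beta> where b: "\<beta> \<in> Sq A" "cleft A \<beta> = v" "cright A \<beta> = v" "\<alpha> \<parallel> \<beta> = hunit A v"
    using assms by (auto simp: is_hiso_def is_hinverse_def)
  have "\<alpha> = \<alpha> \<parallel> (\<alpha> \<parallel> \<beta>)"
    using assms b(4) by simp
  also have "\<dots> = (\<alpha> \<parallel> \<alpha>) \<parallel> \<beta>"
    using assms(1,3,4) b(1,2) by (intro hpaste_assoc[symmetric]) auto
  finally show ?thesis
    using assms b by simp
qed

lemma vassoc_vid_middle:
  "\<lbrakk>v \<in> Ver A; x \<in> Ver A; vtgt A v = a; vsrc A x = a\<rbrakk>
    \<Longrightarrow> vassoc A v (vid A a) x = hunit A (x \<bullet> v)"
  using triangle[of v x] by auto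

text \<open>Kelly's argument: in a pentagon with two adjacent identities the triangle law removes all
  associativity cells but three copies of the one in question, so this isomorphism is idempotent.\<close>

lemma vassoc_vid_first:
  assumes "v \<in> Ver A" "x \<in> Ver A" "vsrc A v = a" "vtgt A v = vsrc A x"
  shows "vassoc A (vid A a) v x = hunit A (x \<bullet> v)"
proof -
  have a: "a \<in> Obj A"
    using assms by auto
  note cell = vassoc_cell[of "vid A a" v x, unfolded is_globular_def is_cell_def]
  have "vassoc A (vid A a) v x \<parallel> vassoc A (vid A a) v x = vassoc A (vid A a) v x"
    using pentagon[of "vid A a" "vid A a" v x] assms a cell
    by (simp add: vassoc_vid_middle hunit_vcomp)
  then show ?thesis
    using assms a cell vassoc_iso[of "vid A a" v x] by (intro hiso_idempotent) auto
qed

lemma vassoc_vid_last: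
  assumes "u \<in> Ver A" "v \<in> Ver A" "vtgt A u = vsrc A v" "vtgt A v = a"
  shows "vassoc A u v (vid A a) = hunit A (v \<bullet> u)"
proof -
  have a: "a \<in> Obj A"
    using assms by auto
  note cell = vassoc_cell[of u v "vid A a", unfolded is_globular_def is_cell_def]
  have "vassoc A u v (vid A a) \<parallel> vassoc A u v (vid A a) = vassoc A u v (vid A a)"
    using pentagon[of u v "vid A a" "vid A a"] assms a cell
    by (simp add: vassoc_vid_middle hunit_vcomp)
  then show ?thesis
    using assms a cell vassoc_iso[of u v "vid A a"] by (intro hiso_idempotent) auto
qed

lemma vassoc_vid:
  assumes "u \<in> Ver A" "v \<in> Ver A" "w \<in> Ver A" "vtgt A u = vsrc A v" "vtgt A v = vsrc A w"
    and "u = vid A (vsrc A u) \<or> v = vid A (vsrc A v) \<or> w = vid A (vsrc A w)"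
  shows "vassoc A u v w = hunit A (w \<bullet> (v \<bullet> u))" "(w \<bullet> v) \<bullet> u = w \<bullet> (v \<bullet> u)"
proof -
  have identity: "vtgt A x = vsrc A x" if "x \<in> Ver A" "x = vid A (vsrc A x)" for x
    by (subst that(2)) (simp add: that(1))
  from assms(6) show trivial: "vassoc A u v w = hunit A (w \<bullet> (v \<bullet> u))"
  proof (elim disjE)
    assume u: "u = vid A (vsrc A u)"
    then have "v \<bullet> u = v"
      using identity[OF assms(1)] assms(2,4) by (metis vcomp_vid_right)
    then show ?thesis
      using vassoc_vid_first[of v w "vsrc A u"] identity[OF assms(1) u] assms(2-5) by (simp flip: u)
  next
    assume v: "v = vid A (vsrc A v)"
    then have "v \<bullet> u = u"
      using assms(1,4) by (metis vcomp_vid_left)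
    then show ?thesis
      using vassoc_vid_middle[of u w "vsrc A v"] identity[OF assms(2) v] assms(1,3-5)
      by (simp flip: v)
  next
    assume w: "w = vid A (vsrc A w)"
    then have "w \<bullet> (v \<bullet> u) = v \<bullet> u"
      using vcomp_vid_left[of "v \<bullet> u"] assms(1,2,4,5) by simp
    then show ?thesis
      using vassoc_vid_last[of u v "vsrc A w"] assms(1,2,4,5) by (simp flip: w)
  qed
  show "(w \<bullet> v) \<bullet> u = w \<bullet> (v \<bullet> u)"
    using vassoc_cell[OF assms(1-5)] assms(1-5)
    unfolding trivial is_globular_def is_cell_def by simp
qed

text \<open>Naturality of the associativity cells gives strict associativity once the cells on both sides
  are identities; the identity may sit in different rows on the left and on the right.\<close>

lemma vpaste_assoc:
  assumes "\<alpha> \<in> Sq A" "\<beta> \<in> Sq A" "\<gamma> \<in> Sq A" "cbot A \<alpha> = ctop A \<beta>" "cbot A \<beta> = ctop A \<gamma>"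
    and "cleft A \<alpha> = vid A (hsrc A (ctop A \<alpha>)) \<or> cleft A \<beta> = vid A (hsrc A (ctop A \<beta>))
      \<or> cleft A \<gamma> = vid A (hsrc A (ctop A \<gamma>))"
    and "cright A \<alpha> = vid A (htgt A (ctop A \<alpha>)) \<or> cright A \<beta> = vid A (htgt A (ctop A \<beta>))
      \<or> cright A \<gamma> = vid A (htgt A (ctop A \<gamma>))"
  shows "(\<alpha> \<div> \<beta>) \<div> \<gamma> = \<alpha> \<div> (\<beta> \<div> \<gamma>)"
proof -
  have matching:
    "vtgt A (cleft A \<alpha>) = vsrc A (cleft A \<beta>)" "vtgt A (cleft A \<beta>) = vsrc A (cleft A \<gamma>)"
    "vtgt A (cright A \<alpha>) = vsrc A (cright A \<beta>)" "vtgt A (cright A \<beta>) = vsrc A (cright A \<gamma>)"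
    using assms(1-5) by (simp_all add: corner_tl corner_tr corner_bl corner_br)
  have "cleft A \<alpha> = vid A (vsrc A (cleft A \<alpha>)) \<or> cleft A \<beta> = vid A (vsrc A (cleft A \<beta>))
      \<or> cleft A \<gamma> = vid A (vsrc A (cleft A \<gamma>))"
    using assms(6) by (simp only: corner_tl assms(1-3))
  note left = vassoc_vid[OF _ _ _ matching(1,2) this]
  have "cright A \<alpha> = vid A (vsrc A (cright A \<alpha>)) \<or> cright A \<beta> = vid A (vsrc A (cright A \<beta>))
      \<or> cright A \<gamma> = vid A (vsrc A (cright A \<gamma>))"
    using assms(7) by (simp only: corner_tr assms(1-3))
  note right = vassoc_vid[OF _ _ _ matching(3,4) this]
  have "\<alpha> \<div> (\<beta> \<div> \<gamma>) = (\<alpha> \<div> (\<beta> \<div> \<gamma>)) \<parallel> vassoc A (cright A \<alpha>) (cright A \<beta>) (cright A \<gamma>)"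
    using assms(1-5) by (subst right(1)) (simp_all add: right(2))
  also have "\<dots> = vassoc A (cleft A \<alpha>) (cleft A \<beta>) (cleft A \<gamma>) \<parallel> ((\<alpha> \<div> \<beta>) \<div> \<gamma>)"
    by (rule vassoc_natural) (use assms(1-5) in simp_all)
  also have "\<dots> = (\<alpha> \<div> \<beta>) \<div> \<gamma>"
    using assms(1-5) by (subst left(1)) simp_all
  finally show ?thesis
    by simp
qed

section \<open>Cells on identities\<close>

text \<open>By interchange, it does not matter in which direction a scalar is pasted to a cell, where both
  directions make sense.\<close>

lemma scalar_hpaste:
  assumes "is_scalar A a x" "\<alpha> \<in> Sq A" "cleft A \<alpha> = vid A a" "ctop A \<alpha> = hid A a"
  shows "x \<parallel> \<alpha> = x \<div> \<alpha>"
  using interchange[of x "vunit A (hid A a)" "vunit A (hid A a)" \<alpha>] assms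
  by (simp add: is_scalar_def is_cell_def)

lemma hpaste_scalar:
  assumes "is_scalar A a x" "\<alpha> \<in> Sq A" "cright A \<alpha> = vid A a" "cbot A \<alpha> = hid A a"
  shows "\<alpha> \<parallel> x = \<alpha> \<div> x"
  using interchange[of \<alpha> "vunit A (hid A a)" "vunit A (hid A a)" x] assms
  by (simp add: is_scalar_def is_cell_def)

lemma scalar_commute:
  assumes "is_scalar A a x" "is_scalar A a y"
  shows "x \<div> y = y \<div> x"
proof -
  have "x \<div> y = x \<parallel> y"
    using assms scalar_hpaste[of a x y] by (simp add: is_scalar_def is_cell_def)
  also have "\<dots> = y \<div> x"
    using interchange[of "vunit A (hid A a)" y x "vunit A (hid A a)"] assms
    by (simp add: is_scalar_def is_cell_def)
  finally show ?thesis .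
qed

end

context double_category_with_companions
begin

section \<open>Binding cells\<close>

lemma star_boundary [simp]:
  assumes "f \<in> Hor A"
  shows "star A f \<in> Ver A" "vsrc A (star A f) = hsrc A f" "vtgt A (star A f) = htgt A f"
  using companion[OF assms] by (auto simp: is_companion_def)

lemma psi_boundary [simp]:
  assumes "f \<in> Hor A"
  shows "psi A f \<in> Sq A" "ctop A (psi A f) = hid A (hsrc A f)"
    "cleft A (psi A f) = vid A (hsrc A f)" "cright A (psi A f) = star A f" "cbot A (psi A f) = f"
  using companion[OF assms] by (auto simp: is_companion_def is_cell_def)

lemma chi_boundary [simp]:
  assumes "f \<in> Hor A"
  shows "chi A f \<in> Sq A" "ctop A (chi A f) = f" "cleft A (chi A f) = star A f"
    "cright A (chi A f) = vid A (htgt A f)" "cbot A (chi A f) = hid A (htgt A f)"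
  using companion[OF assms] by (auto simp: is_companion_def is_cell_def)

lemma binding_equations [simp]:
  assumes "f \<in> Hor A"
  shows "psi A f \<parallel> chi A f = vunit A f" "psi A f \<div> chi A f = hunit A (star A f)"
  using companion[OF assms] by (auto simp: is_companion_def)

declare star_hid [simp]

lemma unit_binding_scalar:
  assumes "a \<in> Obj A"
  shows "is_scalar A a (psi A (hid A a))" "is_scalar A a (chi A (hid A a))"
  using assms by (auto simp: is_scalar_def is_cell_def)

lemma unit_binding_inverse [simp]:
  "a \<in> Obj A \<Longrightarrow> chi A (hid A a) \<div> psi A (hid A a) = vunit A (hid A a)"
  using scalar_commute[OF unit_binding_scalar, of a] by simp

text \<open>The binding cells of an identity need not be identities. But \<open>\<chi>\<close> of an identity slides past
  \<open>\<psi>\<^sub>g\<close>, and \<open>\<psi>\<close> of an identity past \<open>\<chi>\<^sub>f\<close>, so they can be brought to the edge of a pasting and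
  cancelled there.\<close>

lemma psi_slide:
  assumes "g \<in> Hor A" "hsrc A g = c"
  shows "psi A g \<div> (chi A (hid A c) \<parallel> vunit A g) = chi A (hid A c) \<div> psi A g"
proof -
  have c: "c \<in> Obj A"
    using assms by auto
  have "psi A g \<div> (chi A (hid A c) \<parallel> vunit A g) = chi A (hid A c) \<parallel> psi A g"
    using interchange[of "vunit A (hid A c)" "psi A g" "chi A (hid A c)" "vunit A g"] assms c
    by simp
  then show ?thesis
    using scalar_hpaste[OF unit_binding_scalar(2), of c "psi A g"] assms c by simp
qed

lemma chi_slide:
  assumes "f \<in> Hor A" "htgt A f = b"
  shows "(vunit A f \<parallel> psi A (hid A b)) \<div> chi A f = chi A f \<div> psi A (hid A b)"
proof -
  have b: "b \<in> Obj A"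
    using assms by auto
  have "(vunit A f \<parallel> psi A (hid A b)) \<div> chi A f = chi A f \<parallel> psi A (hid A b)"
    using interchange[of "vunit A f" "psi A (hid A b)" "chi A f" "vunit A (hid A b)"] assms b
    by simp
  then show ?thesis
    using hpaste_scalar[OF unit_binding_scalar(1), of b "chi A f"] assms b by simp
qed

lemma star_square_hid_left:
  "\<lbrakk>g \<in> Hor A; hsrc A g = c\<rbrakk>
    \<Longrightarrow> star_square A (hid A c) (hid A c) g g = chi A (hid A c) \<div> psi A g"
  using psi_slide[of g c] by (auto simp: star_square_def)

lemma star_square_hid_right:
  "\<lbrakk>g \<in> Hor A; htgt A g = d\<rbrakk>
    \<Longrightarrow> star_square A g g (hid A d) (hid A d) = chi A g \<div> psi A (hid A d)"
  using chi_slide[of g d] by (auto simp: star_square_def)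

lemma star_split_hid_right:
  assumes "f \<in> Hor A" "hsrc A f = a"
  shows "star_split A f (hid A a) = psi A (hid A a) \<div> hunit A (star A f)"
  using vpaste_assoc[of "psi A (hid A a)" "psi A f" "chi A f"] assms
  by (auto simp: star_split_def)

lemma star_split_hid_left:
  assumes "f \<in> Hor A" "htgt A f = b"
  shows "star_split A (hid A b) f = hunit A (star A f) \<div> psi A (hid A b)"
  using vpaste_assoc[of "psi A f" "vunit A f \<parallel> psi A (hid A b)" "chi A f"]
    vpaste_assoc[of "psi A f" "chi A f" "psi A (hid A b)"] chi_slide[OF assms] assms
  by (auto simp: star_split_def)

lemma star_merge_hid_right:
  assumes "g \<in> Hor A" "hsrc A g = c"
  shows "star_merge A g (hid A c) = chi A (hid A c) \<div> hunit A (star A g)"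
  using vpaste_assoc[of "psi A g" "chi A (hid A c) \<parallel> vunit A g" "chi A g"]
    vpaste_assoc[of "chi A (hid A c)" "psi A g" "chi A g"] psi_slide[OF assms] assms
  by (auto simp: star_merge_def)

lemma star_merge_hid_left:
  assumes "g \<in> Hor A" "htgt A g = d"
  shows "star_merge A (hid A d) g = hunit A (star A g) \<div> chi A (hid A d)"
  using vpaste_assoc[of "psi A g" "chi A g" "chi A (hid A d)"] assms
  by (auto simp: star_merge_def)

section \<open>Identity retrocells\<close>

lemma retro_id_is_retrocell: "v \<in> Ver A \<Longrightarrow> is_retrocell A (retro_id A v)"
  by (simp add: is_retrocell_def retro_id_def is_globular_def is_cell_def)

text \<open>In a composite with an identity retrocell all associativity cells are trivial, and the
  canonical isomorphisms reduce to copies of \<open>\<psi>\<close> and \<open>\<chi>\<close> of identity arrows. One such pair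
  cancels in the middle of the composite, the other along its edge.\<close>

lemma retro_comp_retro_id_left:
  assumes "is_retrocell A \<rho>"
  shows "retro_comp A (retro_id A (rleft \<rho>)) \<rho> = \<rho>"
proof -
  obtain f v w g \<beta> where \<rho>: "\<rho> = \<lparr>rtop = f, rleft = v, rright = w, rbot = g, rcell = \<beta>\<rparr>"
    by (cases \<rho>) auto
  define a b c d where "a = vsrc A v" "b = vsrc A w" "c = vtgt A v" "d = vtgt A w"
  then have arrows [simp]: "f \<in> Hor A" "g \<in> Hor A" "v \<in> Ver A" "w \<in> Ver A"
      "hsrc A f = a" "htgt A f = b" "hsrc A g = c" "htgt A g = d"
      "vsrc A v = a" "vtgt A v = c" "vsrc A w = b" "vtgt A w = d"
    and \<beta> [simp]: "\<beta> \<in> Sq A" "ctop A \<beta> = hid A a" "cbot A \<beta> = hid A d"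
      "cleft A \<beta> = w \<bullet> star A f" "cright A \<beta> = star A g \<bullet> v"
    using assms by (auto simp: \<rho> is_retrocell_def is_globular_def is_cell_def)
  have [simp]: "a \<in> Obj A" "b \<in> Obj A" "c \<in> Obj A" "d \<in> Obj A"
    using vsrc_in[of v] vsrc_in[of w] vtgt_in[of v] vtgt_in[of w] by simp_all
  let ?\<psi> = "psi A (hid A a)" and ?\<chi> = "chi A (hid A a)"
  let ?\<psi>' = "psi A (hid A c)" and ?\<chi>' = "chi A (hid A c)"
  let ?u = "star A g \<bullet> v"
  have split: "(?\<psi> \<div> hunit A (star A f)) \<div> hunit A w = ?\<psi> \<div> hunit A (w \<bullet> star A f)"
    by (simp add: vpaste_assoc hunit_vcomp)
  have id: "((?\<chi> \<div> hunit A v) \<div> ?\<psi>') \<div> hunit A (star A g)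
      = ?\<chi> \<div> (hunit A v \<div> (?\<psi>' \<div> hunit A (star A g)))"
    by (simp add: vpaste_assoc)
  \<comment> \<open>The \<open>\<psi>\<close> below \<open>v\<close> in the identity retrocell meets the \<open>\<chi>\<close> of the merging isomorphism.\<close>
  have "(?\<psi>' \<div> hunit A (star A g)) \<parallel> (?\<chi>' \<div> hunit A (star A g)) = hunit A (star A g)"
    using interchange[of ?\<psi>' ?\<chi>' "hunit A (star A g)" "hunit A (star A g)"] by simp
  then have merge: "(hunit A v \<div> (?\<psi>' \<div> hunit A (star A g))) \<parallel> (hunit A v \<div> (?\<chi>' \<div> hunit A (star A g)))
      = hunit A ?u"
    using interchange[of "hunit A v" "hunit A v" "?\<psi>' \<div> hunit A (star A g)"
      "?\<chi>' \<div> hunit A (star A g)"] by (simp add: hunit_vcomp)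
  have mid: "(?\<chi> \<div> (hunit A v \<div> (?\<psi>' \<div> hunit A (star A g)))) \<parallel> (hunit A v \<div> (?\<chi>' \<div> hunit A (star A g)))
      = ?\<chi> \<div> hunit A ?u"
    using interchange[of ?\<chi> "vunit A (hid A a)" "hunit A v \<div> (?\<psi>' \<div> hunit A (star A g))"
      "hunit A v \<div> (?\<chi>' \<div> hunit A (star A g))"] by (simp add: merge)
  \<comment> \<open>The splitting isomorphism and the rest of the identity retrocell leave a \<open>\<psi>\<close> and a \<open>\<chi>\<close>
    above \<open>\<beta>\<close>.\<close>
  have "(?\<psi> \<div> hunit A (w \<bullet> star A f)) \<parallel> \<beta> = ?\<psi> \<div> \<beta>"
    using interchange[of ?\<psi> "vunit A (hid A a)" "hunit A (w \<bullet> star A f)" \<beta>] by simp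
  moreover have "(?\<psi> \<div> \<beta>) \<parallel> (?\<chi> \<div> hunit A ?u) = \<beta>"
    using interchange[of ?\<psi> ?\<chi> \<beta> "hunit A ?u"] by simp
  ultimately show ?thesis
    by (simp add: \<rho> retro_comp_def retro_id_def star_split_hid_right star_merge_hid_right
        vassoc_vid_first vassoc_vid_middle hinv_hunit split id mid hpaste_assoc)
qed

lemma retro_comp_retro_id_right:
  assumes "is_retrocell A \<rho>"
  shows "retro_comp A \<rho> (retro_id A (rright \<rho>)) = \<rho>"
proof -
  obtain f v w g \<beta> where \<rho>: "\<rho> = \<lparr>rtop = f, rleft = v, rright = w, rbot = g, rcell = \<beta>\<rparr>"
    by (cases \<rho>) auto
  define a b c d where "a = vsrc A v" "b = vsrc A w" "c = vtgt A v" "d = vtgt A w"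
  then have arrows [simp]: "f \<in> Hor A" "g \<in> Hor A" "v \<in> Ver A" "w \<in> Ver A"
      "hsrc A f = a" "htgt A f = b" "hsrc A g = c" "htgt A g = d"
      "vsrc A v = a" "vtgt A v = c" "vsrc A w = b" "vtgt A w = d"
    and \<beta> [simp]: "\<beta> \<in> Sq A" "ctop A \<beta> = hid A a" "cbot A \<beta> = hid A d"
      "cleft A \<beta> = w \<bullet> star A f" "cright A \<beta> = star A g \<bullet> v"
    using assms by (auto simp: \<rho> is_retrocell_def is_globular_def is_cell_def)
  have [simp]: "a \<in> Obj A" "b \<in> Obj A" "c \<in> Obj A" "d \<in> Obj A"
    using vsrc_in[of v] vsrc_in[of w] vtgt_in[of v] vtgt_in[of w] by simp_all
  let ?\<psi> = "psi A (hid A b)" and ?\<chi> = "chi A (hid A b)"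
  let ?\<psi>' = "psi A (hid A d)" and ?\<chi>' = "chi A (hid A d)"
  let ?u = "w \<bullet> star A f"
  let ?f = "hunit A (star A f)"
  have split: "(?f \<div> ?\<psi>) \<div> hunit A w = ?f \<div> (?\<psi> \<div> hunit A w)"
    by (simp add: vpaste_assoc)
  have id: "?f \<div> ((?\<chi> \<div> hunit A w) \<div> ?\<psi>') = (?f \<div> (?\<chi> \<div> hunit A w)) \<div> ?\<psi>'"
    by (simp add: vpaste_assoc)
  have merge: "hunit A v \<div> (hunit A (star A g) \<div> ?\<chi>') = hunit A (star A g \<bullet> v) \<div> ?\<chi>'"
    using vpaste_assoc[of "hunit A v" "hunit A (star A g)" ?\<chi>'] by (simp add: hunit_vcomp)
  \<comment> \<open>The \<open>\<psi>\<close> of the splitting isomorphism meets the \<open>\<chi>\<close> above \<open>w\<close> in the identity retrocell.\<close>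
  have "(?\<psi> \<div> hunit A w) \<parallel> (?\<chi> \<div> hunit A w) = hunit A w"
    using interchange[of ?\<psi> ?\<chi> "hunit A w" "hunit A w"] by simp
  then have "(?f \<div> (?\<psi> \<div> hunit A w)) \<parallel> (?f \<div> (?\<chi> \<div> hunit A w)) = hunit A ?u"
    using interchange[of ?f ?f "?\<psi> \<div> hunit A w" "?\<chi> \<div> hunit A w"] by (simp add: hunit_vcomp)
  then have mid: "(?f \<div> (?\<psi> \<div> hunit A w)) \<parallel> ((?f \<div> (?\<chi> \<div> hunit A w)) \<div> ?\<psi>') = hunit A ?u \<div> ?\<psi>'"
    using interchange[of "?f \<div> (?\<psi> \<div> hunit A w)" "?f \<div> (?\<chi> \<div> hunit A w)"
      "vunit A (hid A d)" ?\<psi>'] by simp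
  \<comment> \<open>The rest of the identity retrocell and the merging isomorphism leave a \<open>\<psi>\<close> and a \<open>\<chi>\<close>
    below \<open>\<beta>\<close>.\<close>
  have "(hunit A ?u \<div> ?\<psi>') \<parallel> \<beta> = \<beta> \<div> ?\<psi>'"
    using interchange[of "hunit A ?u" \<beta> ?\<psi>' "vunit A (hid A d)"] by simp
  moreover have "(\<beta> \<div> ?\<psi>') \<parallel> (hunit A (star A g \<bullet> v) \<div> ?\<chi>') = \<beta>"
    using interchange[of \<beta> "hunit A (star A g \<bullet> v)" ?\<psi>' ?\<chi>'] by simp
  ultimately show ?thesis
    by (simp add: \<rho> retro_comp_def retro_id_def star_split_hid_left star_merge_hid_left
        vassoc_vid_last vassoc_vid_middle hinv_hunit split id merge mid)
qed

section \<open>Inverses of the globular cell\<close>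

text \<open>The binding equations let \<open>\<psi>\<^sub>g\<close> and \<open>\<chi>\<^sub>f\<close> be moved across an equation between cells, so the
  two equations for an inverse of the globular cell unfold to equations about \<open>\<alpha>\<close> itself.\<close>

lemma is_hinverse_commuter_hat_iff:
  assumes \<alpha>: "is_cell A f v w g \<alpha>"
    and \<beta>: "is_globular A (w \<bullet> star A f) (star A g \<bullet> v) \<beta>"
  shows "is_hinverse A (commuter_hat A \<alpha>) \<beta> \<longleftrightarrow>
    (psi A f \<div> \<alpha>) \<parallel> \<beta> = hunit A v \<div> psi A g \<and> \<beta> \<parallel> (\<alpha> \<div> chi A g) = chi A f \<div> hunit A w"
proof -
  define a b c d where "a = vsrc A v" "b = vsrc A w" "c = vtgt A v" "d = vtgt A w"
  then have arrows [simp]: "f \<in> Hor A" "g \<in> Hor A" "v \<in> Ver A" "w \<in> Ver A"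
      "hsrc A f = a" "htgt A f = b" "hsrc A g = c" "htgt A g = d"
      "vsrc A v = a" "vtgt A v = c" "vsrc A w = b" "vtgt A w = d"
    and \<alpha>' [simp]: "\<alpha> \<in> Sq A" "ctop A \<alpha> = f" "cbot A \<alpha> = g" "cleft A \<alpha> = v" "cright A \<alpha> = w"
    using \<alpha> corner_tl[of \<alpha>] corner_tr[of \<alpha>] corner_bl[of \<alpha>] corner_br[of \<alpha>]
    by (auto simp: is_cell_def)
  have \<beta>' [simp]: "\<beta> \<in> Sq A" "ctop A \<beta> = hid A a" "cbot A \<beta> = hid A d"
      "cleft A \<beta> = w \<bullet> star A f" "cright A \<beta> = star A g \<bullet> v"
    using \<beta> by (auto simp: is_globular_def is_cell_def)
  have [simp]: "a \<in> Obj A" "b \<in> Obj A" "c \<in> Obj A" "d \<in> Obj A"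
    using vsrc_in[of v] vsrc_in[of w] vtgt_in[of v] vtgt_in[of w] by simp_all
  let ?h = "commuter_hat A \<alpha>"
  have hat: "?h = (psi A f \<div> \<alpha>) \<div> chi A g" "?h = psi A f \<div> (\<alpha> \<div> chi A g)"
    by (simp_all add: commuter_hat_def vpaste_assoc)
  have [simp]: "?h \<in> Sq A" "cleft A ?h = star A g \<bullet> v" "cright A ?h = w \<bullet> star A f"
    by (simp_all add: hat(1))
  have inverse_iff: "is_hinverse A ?h \<beta> \<longleftrightarrow>
      ?h \<parallel> \<beta> = hunit A (star A g \<bullet> v) \<and> \<beta> \<parallel> ?h = hunit A (w \<bullet> star A f)"
    by (simp add: is_hinverse_def)
  have hat_right: "?h \<parallel> \<beta> = ((psi A f \<div> \<alpha>) \<parallel> \<beta>) \<div> chi A g"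
    using interchange[of "psi A f \<div> \<alpha>" \<beta> "chi A g" "vunit A (hid A d)"] by (simp add: hat(1))
  have hat_left: "\<beta> \<parallel> ?h = psi A f \<div> (\<beta> \<parallel> (\<alpha> \<div> chi A g))"
    using interchange[of "vunit A (hid A a)" "psi A f" \<beta> "\<alpha> \<div> chi A g"] by (simp add: hat(2))
  have absorb_right: "(hunit A v \<div> psi A g) \<parallel> ?h = psi A f \<div> \<alpha>"
    using interchange[of "hunit A v" "psi A f \<div> \<alpha>" "psi A g" "chi A g"] by (simp add: hat(1))
  have absorb_left: "?h \<parallel> (chi A f \<div> hunit A w) = \<alpha> \<div> chi A g"
    using interchange[of "psi A f" "chi A f" "\<alpha> \<div> chi A g" "hunit A w"] by (simp add: hat(2))
  show ?thesis
    unfolding inverse_iff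
  proof (intro iffI conjI; elim conjE)
    assume "?h \<parallel> \<beta> = hunit A (star A g \<bullet> v)"
    then show "(psi A f \<div> \<alpha>) \<parallel> \<beta> = hunit A v \<div> psi A g"
      using hpaste_assoc[of "hunit A v \<div> psi A g" ?h \<beta>] by (simp add: absorb_right)
  next
    assume "\<beta> \<parallel> ?h = hunit A (w \<bullet> star A f)"
    then show "\<beta> \<parallel> (\<alpha> \<div> chi A g) = chi A f \<div> hunit A w"
      using hpaste_assoc[of \<beta> ?h "chi A f \<div> hunit A w"] by (simp add: absorb_left)
  next
    assume "(psi A f \<div> \<alpha>) \<parallel> \<beta> = hunit A v \<div> psi A g"
    then show "?h \<parallel> \<beta> = hunit A (star A g \<bullet> v)"
      by (simp add: hat_right vpaste_assoc hunit_vcomp)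
  next
    assume "\<beta> \<parallel> (\<alpha> \<div> chi A g) = chi A f \<div> hunit A w"
    then show "\<beta> \<parallel> ?h = hunit A (w \<bullet> star A f)"
      using vpaste_assoc[of "psi A f" "chi A f" "hunit A w"] by (simp add: hat_left hunit_vcomp)
  qed
qed

section \<open>Binding cells of a companion\<close>

lemma var_psi_iff:
  assumes \<alpha>: "is_cell A f v w g \<alpha>"
    and \<rho>: "is_retrocell A \<lparr>rtop = f, rleft = v, rright = w, rbot = g, rcell = \<beta>\<rparr>"
  shows "is_var_cell A \<lparr>vc_top = hunit A v, vc_left = retro_id A v,
      vc_right = \<lparr>rtop = f, rleft = v, rright = w, rbot = g, rcell = \<beta>\<rparr>, vc_bot = \<alpha>\<rparr>
    \<longleftrightarrow> (psi A f \<div> \<alpha>) \<parallel> \<beta> = hunit A v \<div> psi A g"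
proof -
  define a b c d where "a = vsrc A v" "b = vsrc A w" "c = vtgt A v" "d = vtgt A w"
  then have arrows [simp]: "f \<in> Hor A" "g \<in> Hor A" "v \<in> Ver A" "w \<in> Ver A"
      "hsrc A f = a" "htgt A f = b" "hsrc A g = c" "htgt A g = d"
      "vsrc A v = a" "vtgt A v = c" "vsrc A w = b" "vtgt A w = d"
    and \<beta> [simp]: "\<beta> \<in> Sq A" "ctop A \<beta> = hid A a" "cbot A \<beta> = hid A d"
      "cleft A \<beta> = w \<bullet> star A f" "cright A \<beta> = star A g \<bullet> v"
    using \<rho> by (auto simp: is_retrocell_def is_globular_def is_cell_def)
  have [simp]: "a \<in> Obj A" "b \<in> Obj A" "c \<in> Obj A" "d \<in> Obj A"
    using vsrc_in[of v] vsrc_in[of w] vtgt_in[of v] vtgt_in[of w] by simp_all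
  have [simp]: "\<alpha> \<in> Sq A" "ctop A \<alpha> = f" "cbot A \<alpha> = g" "cleft A \<alpha> = v" "cright A \<alpha> = w"
    using \<alpha> by (auto simp: is_cell_def)
  let ?\<psi> = "psi A (hid A a)" and ?\<chi> = "chi A (hid A a)"
  let ?\<psi>' = "psi A (hid A c)" and ?\<chi>' = "chi A (hid A c)"
  have "?\<psi>' \<parallel> (?\<chi>' \<div> psi A g) = psi A g"
    using interchange[of ?\<psi>' ?\<chi>' "vunit A (hid A c)" "psi A g"] by simp
  then have "(hunit A v \<div> ?\<psi>') \<parallel> (hunit A v \<div> (?\<chi>' \<div> psi A g)) = hunit A v \<div> psi A g"
    using interchange[of "hunit A v" "hunit A v" ?\<psi>' "?\<chi>' \<div> psi A g"] by simp
  then have "(?\<chi> \<div> (hunit A v \<div> ?\<psi>')) \<parallel> (hunit A v \<div> (?\<chi>' \<div> psi A g))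
      = ?\<chi> \<div> (hunit A v \<div> psi A g)"
    using interchange[of ?\<chi> "vunit A (hid A a)" "hunit A v \<div> ?\<psi>'"
      "hunit A v \<div> (?\<chi>' \<div> psi A g)"] by simp
  then have lhs: "((?\<chi> \<div> hunit A v) \<div> ?\<psi>') \<parallel> (hunit A v \<div> (?\<chi>' \<div> psi A g))
      = ?\<chi> \<div> (hunit A v \<div> psi A g)"
    by (simp add: vpaste_assoc)
  have rhs: "((?\<chi> \<div> psi A f) \<div> \<alpha>) \<parallel> \<beta> = ?\<chi> \<div> ((psi A f \<div> \<alpha>) \<parallel> \<beta>)"
    using interchange[of ?\<chi> "vunit A (hid A a)" "psi A f \<div> \<alpha>" \<beta>] by (simp add: vpaste_assoc)
  have cancel: "?\<psi> \<div> (?\<chi> \<div> \<xi>) = \<xi>" if "\<xi> \<in> Sq A" "ctop A \<xi> = hid A a" for \<xi>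
    using vpaste_assoc[of ?\<psi> ?\<chi> \<xi>] that by simp
  have "?\<psi> \<div> (?\<chi> \<div> (hunit A v \<div> psi A g)) = hunit A v \<div> psi A g"
    "?\<psi> \<div> (?\<chi> \<div> ((psi A f \<div> \<alpha>) \<parallel> \<beta>)) = (psi A f \<div> \<alpha>) \<parallel> \<beta>"
    by (rule cancel; simp)+
  then have "?\<chi> \<div> (hunit A v \<div> psi A g) = ?\<chi> \<div> ((psi A f \<div> \<alpha>) \<parallel> \<beta>)
      \<longleftrightarrow> (psi A f \<div> \<alpha>) \<parallel> \<beta> = hunit A v \<div> psi A g"
    by metis
  then show ?thesis
    using \<rho> retro_id_is_retrocell[of v]
    by (simp add: is_var_cell_def Let_def retro_id_def star_square_hid_left lhs rhs)
qed

lemma var_chi_iff: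
  assumes \<alpha>: "is_cell A f v w g \<alpha>"
    and \<rho>: "is_retrocell A \<lparr>rtop = f, rleft = v, rright = w, rbot = g, rcell = \<beta>\<rparr>"
  shows "is_var_cell A \<lparr>vc_top = \<alpha>,
      vc_left = \<lparr>rtop = f, rleft = v, rright = w, rbot = g, rcell = \<beta>\<rparr>,
      vc_right = retro_id A w, vc_bot = hunit A w\<rparr>
    \<longleftrightarrow> \<beta> \<parallel> (\<alpha> \<div> chi A g) = chi A f \<div> hunit A w"
proof -
  define a b c d where "a = vsrc A v" "b = vsrc A w" "c = vtgt A v" "d = vtgt A w"
  then have arrows [simp]: "f \<in> Hor A" "g \<in> Hor A" "v \<in> Ver A" "w \<in> Ver A"
      "hsrc A f = a" "htgt A f = b" "hsrc A g = c" "htgt A g = d"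
      "vsrc A v = a" "vtgt A v = c" "vsrc A w = b" "vtgt A w = d"
    and \<beta> [simp]: "\<beta> \<in> Sq A" "ctop A \<beta> = hid A a" "cbot A \<beta> = hid A d"
      "cleft A \<beta> = w \<bullet> star A f" "cright A \<beta> = star A g \<bullet> v"
    using \<rho> by (auto simp: is_retrocell_def is_globular_def is_cell_def)
  have [simp]: "a \<in> Obj A" "b \<in> Obj A" "c \<in> Obj A" "d \<in> Obj A"
    using vsrc_in[of v] vsrc_in[of w] vtgt_in[of v] vtgt_in[of w] by simp_all
  have [simp]: "\<alpha> \<in> Sq A" "ctop A \<alpha> = f" "cbot A \<alpha> = g" "cleft A \<alpha> = v" "cright A \<alpha> = w"
    using \<alpha> by (auto simp: is_cell_def)
  let ?\<psi> = "psi A (hid A b)" and ?\<chi> = "chi A (hid A b)"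
  let ?\<psi>' = "psi A (hid A d)" and ?\<chi>' = "chi A (hid A d)"
  have lhs: "\<beta> \<parallel> (\<alpha> \<div> (chi A g \<div> ?\<psi>')) = (\<beta> \<parallel> (\<alpha> \<div> chi A g)) \<div> ?\<psi>'"
    using interchange[of \<beta> "\<alpha> \<div> chi A g" "vunit A (hid A d)" ?\<psi>'] by (simp add: vpaste_assoc)
  have "(chi A f \<div> ?\<psi>) \<parallel> ?\<chi> = chi A f"
    using interchange[of "chi A f" "vunit A (hid A b)" ?\<psi> ?\<chi>] by simp
  then have "((chi A f \<div> ?\<psi>) \<div> hunit A w) \<parallel> (?\<chi> \<div> hunit A w) = chi A f \<div> hunit A w"
    using interchange[of "chi A f \<div> ?\<psi>" ?\<chi> "hunit A w" "hunit A w"] by simp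
  then have rhs: "((chi A f \<div> ?\<psi>) \<div> hunit A w) \<parallel> ((?\<chi> \<div> hunit A w) \<div> ?\<psi>')
      = (chi A f \<div> hunit A w) \<div> ?\<psi>'"
    using interchange[of "(chi A f \<div> ?\<psi>) \<div> hunit A w" "?\<chi> \<div> hunit A w"
      "vunit A (hid A d)" ?\<psi>'] by simp
  have cancel: "(\<xi> \<div> ?\<psi>') \<div> ?\<chi>' = \<xi>" if "\<xi> \<in> Sq A" "cbot A \<xi> = hid A d" for \<xi>
    using vpaste_assoc[of \<xi> ?\<psi>' ?\<chi>'] that by simp
  have "((\<beta> \<parallel> (\<alpha> \<div> chi A g)) \<div> ?\<psi>') \<div> ?\<chi>' = \<beta> \<parallel> (\<alpha> \<div> chi A g)"
    "((chi A f \<div> hunit A w) \<div> ?\<psi>') \<div> ?\<chi>' = chi A f \<div> hunit A w"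
    by (rule cancel; simp)+
  then have "(\<beta> \<parallel> (\<alpha> \<div> chi A g)) \<div> ?\<psi>' = (chi A f \<div> hunit A w) \<div> ?\<psi>'
      \<longleftrightarrow> \<beta> \<parallel> (\<alpha> \<div> chi A g) = chi A f \<div> hunit A w"
    by metis
  then show ?thesis
    using \<rho> retro_id_is_retrocell[of w]
    by (simp add: is_var_cell_def Let_def retro_id_def star_square_hid_right lhs rhs)
qed

text \<open>If the companion has top \<open>f'\<close> and bottom \<open>g'\<close>, then the conditions on horizontal arrows for
  its first binding cell are \<open>f \<cdot> 1 = f' \<cdot> 1\<close> and \<open>g \<cdot> 1 = g' \<cdot> 1\<close>.\<close>

lemma var_companionE:
  assumes \<alpha>: "is_cell A f v w g \<alpha>" and "is_companion (Var A) \<alpha> \<rho> \<psi> \<chi>"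
  obtains \<beta> where "is_retrocell A \<lparr>rtop = f, rleft = v, rright = w, rbot = g, rcell = \<beta>\<rparr>"
    and "is_var_cell A \<lparr>vc_top = hunit A v, vc_left = retro_id A v,
      vc_right = \<lparr>rtop = f, rleft = v, rright = w, rbot = g, rcell = \<beta>\<rparr>, vc_bot = \<alpha>\<rparr>"
    and "is_var_cell A \<lparr>vc_top = \<alpha>,
      vc_left = \<lparr>rtop = f, rleft = v, rright = w, rbot = g, rcell = \<beta>\<rparr>,
      vc_right = retro_id A w, vc_bot = hunit A w\<rparr>"
proof -
  have [simp]: "\<alpha> \<in> Sq A" "ctop A \<alpha> = f" "cbot A \<alpha> = g" "cleft A \<alpha> = v" "cright A \<alpha> = w"
    using \<alpha> by (auto simp: is_cell_def)
  have [simp]: "v \<in> Ver A" "f \<in> Hor A" "g \<in> Hor A" "hsrc A f = vsrc A v" "hsrc A g = vtgt A v"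
    using cleft_in[of \<alpha>] ctop_in[of \<alpha>] cbot_in[of \<alpha>] corner_tl[of \<alpha>] corner_bl[of \<alpha>] by simp_all
  have \<rho>: "is_retrocell A \<rho>" "rleft \<rho> = v" "rright \<rho> = w"
    and \<psi>: "\<psi> = \<lparr>vc_top = hunit A v, vc_left = retro_id A v, vc_right = \<rho>, vc_bot = \<alpha>\<rparr>"
      "is_var_cell A \<psi>"
    and \<chi>: "\<chi> = \<lparr>vc_top = \<alpha>, vc_left = \<rho>, vc_right = retro_id A w, vc_bot = hunit A w\<rparr>"
      "is_var_cell A \<chi>"
    using assms(2) by (auto simp: is_companion_def is_cell_def Var_def)
  have "rtop \<rho> = f" "rbot \<rho> = g"
    using \<psi> \<rho> by (auto simp: is_var_cell_def Let_def retro_id_def is_retrocell_def)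
  then have "\<rho> = \<lparr>rtop = f, rleft = v, rright = w, rbot = g, rcell = rcell \<rho>\<rparr>"
    using \<rho> by simp
  then show thesis
    using that[of "rcell \<rho>"] \<rho>(1) \<psi> \<chi> by simp
qed

text \<open>Since cells of \<open>Var A\<close> are determined by their boundaries, the first companion equation is
  automatic, and the second is the pair of unit laws for \<open>\<rho>\<close>.\<close>

lemma var_companionI:
  assumes \<alpha>: "is_cell A f v w g \<alpha>" and \<rho>: "is_retrocell A \<rho>" "rleft \<rho> = v" "rright \<rho> = w"
    and \<psi>: "is_var_cell A \<lparr>vc_top = hunit A v, vc_left = retro_id A v, vc_right = \<rho>, vc_bot = \<alpha>\<rparr>"
    and \<chi>: "is_var_cell A \<lparr>vc_top = \<alpha>, vc_left = \<rho>, vc_right = retro_id A w, vc_bot = hunit A w\<rparr>"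
  shows "has_companion (Var A) \<alpha>"
proof -
  have [simp]: "\<alpha> \<in> Sq A" "cleft A \<alpha> = v" "cright A \<alpha> = w"
    using \<alpha> by (auto simp: is_cell_def)
  have "is_companion (Var A) \<alpha> \<rho>
      \<lparr>vc_top = hunit A v, vc_left = retro_id A v, vc_right = \<rho>, vc_bot = \<alpha>\<rparr>
      \<lparr>vc_top = \<alpha>, vc_left = \<rho>, vc_right = retro_id A w, vc_bot = hunit A w\<rparr>"
    using \<rho> \<psi> \<chi> retro_comp_retro_id_left[OF \<rho>(1)] retro_comp_retro_id_right[OF \<rho>(1)]
    by (simp add: is_companion_def is_cell_def Var_def)
  then show ?thesis
    by (auto simp: has_companion_def)
qed

text \<open>A horizontal inverse of a globular cell is again globular: the tops of the cell and of the
  composite are identities, hence so is the top of the inverse, and likewise for the bottoms.\<close>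

lemma hinverse_commuter_hat_retrocell:
  assumes \<alpha>: "is_cell A f v w g \<alpha>" and \<beta>: "is_hinverse A (commuter_hat A \<alpha>) \<beta>"
  shows "is_retrocell A \<lparr>rtop = f, rleft = v, rright = w, rbot = g, rcell = \<beta>\<rparr>"
proof -
  have [simp]: "\<alpha> \<in> Sq A" "ctop A \<alpha> = f" "cbot A \<alpha> = g" "cleft A \<alpha> = v" "cright A \<alpha> = w"
    using \<alpha> by (auto simp: is_cell_def)
  have [simp]: "f \<in> Hor A" "g \<in> Hor A" "v \<in> Ver A" "w \<in> Ver A"
      "hsrc A f = vsrc A v" "htgt A f = vsrc A w" "hsrc A g = vtgt A v" "htgt A g = vtgt A w"
    using ctop_in[of \<alpha>] cbot_in[of \<alpha>] cleft_in[of \<alpha>] cright_in[of \<alpha>]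
      corner_tl[of \<alpha>] corner_tr[of \<alpha>] corner_bl[of \<alpha>] corner_br[of \<alpha>] by simp_all
  let ?h = "commuter_hat A \<alpha>"
  have [simp]: "?h \<in> Sq A" "cleft A ?h = star A g \<bullet> v" "cright A ?h = w \<bullet> star A f"
      "ctop A ?h = hid A (vsrc A v)" "cbot A ?h = hid A (vtgt A w)"
    by (simp_all add: commuter_hat_def)
  have [simp]: "\<beta> \<in> Sq A" "cleft A \<beta> = w \<bullet> star A f" "cright A \<beta> = star A g \<bullet> v"
    and inv: "?h \<parallel> \<beta> = hunit A (star A g \<bullet> v)"
    using \<beta> by (auto simp: is_hinverse_def)
  have "hsrc A (ctop A \<beta>) = vsrc A v" "hsrc A (cbot A \<beta>) = vtgt A w"
    using corner_tl[of \<beta>] corner_bl[of \<beta>] by simp_all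
  moreover have "ctop A (?h \<parallel> \<beta>) = hid A (vsrc A v)" "cbot A (?h \<parallel> \<beta>) = hid A (vtgt A w)"
    by (simp_all only: inv) simp_all
  ultimately have "ctop A \<beta> = hid A (vsrc A v)" "cbot A \<beta> = hid A (vtgt A w)"
    by simp_all
  then show ?thesis
    by (simp add: is_retrocell_def is_globular_def is_cell_def)
qed

end

theorem proposition11:
  fixes A :: "('o, 'h, 'v, 'c) double_cat_comp"
  assumes "double_category_with_companions A"
    and "is_cell A f v w g \<alpha>"
  shows "commuter_cell A \<alpha> \<longleftrightarrow> has_companion (Var A) \<alpha>"
proof -
  interpret double_category_with_companions A
    by (rule assms(1))
  note \<alpha> = assms(2)
  let ?\<rho> = "\<lambda>\<beta>. \<lparr>rtop = f, rleft = v, rright = w, rbot = g, rcell = \<beta>\<rparr>"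
  let ?\<psi> = "\<lambda>\<beta>. \<lparr>vc_top = hunit A v, vc_left = retro_id A v, vc_right = ?\<rho> \<beta>, vc_bot = \<alpha>\<rparr>"
  let ?\<chi> = "\<lambda>\<beta>. \<lparr>vc_top = \<alpha>, vc_left = ?\<rho> \<beta>, vc_right = retro_id A w, vc_bot = hunit A w\<rparr>"
  have key: "is_hinverse A (commuter_hat A \<alpha>) \<beta> \<longleftrightarrow> is_var_cell A (?\<psi> \<beta>) \<and> is_var_cell A (?\<chi> \<beta>)"
    if "is_retrocell A (?\<rho> \<beta>)" for \<beta>
    using that is_hinverse_commuter_hat_iff[OF \<alpha>, of \<beta>] var_psi_iff[OF \<alpha> that] var_chi_iff[OF \<alpha> that]
    by (simp add: is_retrocell_def)
  show ?thesis
  proof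
    assume "commuter_cell A \<alpha>"
    then obtain \<beta> where \<beta>: "is_hinverse A (commuter_hat A \<alpha>) \<beta>"
      by (auto simp: commuter_cell_def is_hiso_def)
    note \<rho> = hinverse_commuter_hat_retrocell[OF \<alpha> \<beta>]
    then show "has_companion (Var A) \<alpha>"
      using var_companionI[OF \<alpha> \<rho>] \<beta> key[OF \<rho>] by simp
  next
    assume "has_companion (Var A) \<alpha>"
    then obtain \<rho> \<psi> \<chi> where "is_companion (Var A) \<alpha> \<rho> \<psi> \<chi>"
      by (auto simp: has_companion_def)
    then obtain \<beta> where "is_retrocell A (?\<rho> \<beta>)" "is_var_cell A (?\<psi> \<beta>)" "is_var_cell A (?\<chi> \<beta>)"
      by (rule var_companionE[OF \<alpha>])
    then have "is_hinverse A (commuter_hat A \<alpha>) \<beta>"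
      using key by blast
    then show "commuter_cell A \<alpha>"
      by (auto simp: commuter_cell_def is_hiso_def)
  qed
qed

end
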